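(* Let $N>1$ be an integer, let $\{p_i\}_{i=0}^{N-1}$ be positive real numbers with $\sum_{i=0}^{N-1}p_i=1$, and let $\mu$ be the associated Markov Borel probability measure on $K_N=\prod_{j=1}^\infty\mathbb{Z}_N$, i.e. the one determined by $$\mu(Z(i_1i_2\cdots i_n))=\prod_{j=1}^n p_{i_j}\qquad(n\ge1,\ i_1,\dots,i_n\in\mathbb{Z}_N).$$ For $i\in\mathbb{Z}_N$ define $S_i\in B(L^2(K_N,\mu))$ by $$S_i(f)(w)=\chi_{Z(i)}(w)\,p_i^{-1/2}f(\sigma(w)),$$ where $\sigma$ is the one-sided shift on $K_N$. Then there are functions $\{\phi_k\}_{k=0}^{N-1}\subset L^2(K_N,\mu)$ ("scaling functions") and $\{\psi_{j,k}: k\in\mathbb{Z}_N,\ 1\le j\le N-1\}\subset L^2(K_N,\mu)$ ("wavelets") such that, setting $$\mathcal{V}_0=\overline{\mathrm{span}}\{\phi_k: k\in\mathbb{Z}_N\},\qquad \mathcal{W}_0=\overline{\mathrm{span}}\{\psi_{j,k}: k\in\mathbb{Z}_N,\ 1\le j\le N-1\},$$ $$\mathcal{W}_n=\overline{\mathrm{span}}\{S_w(\psi_{j,k}): k\in\mathbb{Z}_N,\ 1\le j\le N-1,\ w\text{ a word of length }n\}\quad(n\ge1),$$ the subspaces $\mathcal{V}_0$ and $\mathcal{W}_n$, $n\ge0$, are pairwise orthogonal and $$L^2(K_N,\mu)=\overline{\mathrm{span}}\Big(\mathcal{V}_0\oplus\Big[\bigoplus_{n=0}^\infty\mathcal{W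}_n\Big]\Big).$$
   Context: $\mathbb{Z}_N=\{0,1,\dots,N-1\}$. $K_N=\prod_{j=1}^\infty\mathbb{Z}_N$ has the product topology (a Cantor set). For $i_1,\dots,i_n\in\mathbb{Z}_N$, the cylinder set is $Z(i_1i_2\cdots i_n)=\{(x_1x_2\cdots)\in K_N: x_1=i_1,\dots,x_n=i_n\}$. The one-sided shift is $\sigma((i_j)_{j=1}^\infty)=(i_{j+1})_{j=1}^\infty$. A word of length $n$ is $w=w_1w_2\cdots w_n$ with $w_i\in\mathbb{Z}_N$, and $S_w=S_{w_1}S_{w_2}\cdots S_{w_n}$. *)

theory Defs
  imports "HOL-Probability.Probability" "HOL-Library.Function_Algebras"
begin

section \<open>The Cantor set \<open>K\<^sub>N\<close>, cylinder sets and the shift\<close>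

text \<open>
  The alphabet \<open>{0, \<dots>, N - 1}\<close> is \<open>{..<N}\<close> and carries the discrete topology. Sequences are
  indexed from \<open>0\<close>, so the \<open>j\<close>-th letter of a point \<open>x\<close> is \<open>x (j - 1)\<close>.
\<close>

definition cantor_top :: "nat \<Rightarrow> (nat \<Rightarrow> nat) topology" where
  "cantor_top N = product_topology (\<lambda>_. discrete_topology {..<N}) UNIV"

definition cantor_space :: "nat \<Rightarrow> (nat \<Rightarrow> nat) set" where
  "cantor_space N = topspace (cantor_top N)"

definition words :: "nat \<Rightarrow> nat \<Rightarrow> nat list set" where
  "words N n = {w. set w \<subseteq> {..<N} \<and> length w = n}"

definition cylinder :: "nat \<Rightarrow> nat list \<Rightarrow> (nat \<Rightarrow> nat) set" where
  "cylinder N w = {x \<in> cantor_space N. \<forall>j<length w. x j = w ! j}"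

definition seq_shift :: "(nat \<Rightarrow> nat) \<Rightarrow> nat \<Rightarrow> nat" where
  "seq_shift x = (\<lambda>j. x (Suc j))"

definition markov_measure :: "nat \<Rightarrow> (nat \<Rightarrow> real) \<Rightarrow> (nat \<Rightarrow> nat) measure \<Rightarrow> bool" where
  "markov_measure N p M \<longleftrightarrow>
     prob_space M \<and>
     space M = cantor_space N \<and>
     sets M = sigma_sets (cantor_space N) {U. openin (cantor_top N) U} \<and>
     (\<forall>n\<ge>1. \<forall>w\<in>words N n. measure M (cylinder N w) = (\<Prod>j<n. p (w ! j)))"


section \<open>The complex Hilbert space \<open>L\<^sup>2(M)\<close>\<close>

text \<open>
  Elements of \<open>L\<^sup>2(M)\<close> are handled through representatives: \<open>L2 M\<close> is the set of square-integrable
  measurable functions, and functions that agree almost everywhere are at distance \<open>0\<close>. All subspaces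
  below are closures with respect to the seminorm \<open>L2_norm\<close>, hence closed under almost everywhere
  equality, so that they correspond exactly to the closed subspaces of the quotient.
\<close>

definition L2 :: "'a measure \<Rightarrow> ('a \<Rightarrow> complex) set" where
  "L2 M = {f. f \<in> borel_measurable M \<and> integrable M (\<lambda>x. (cmod (f x))\<^sup>2)}"

definition L2_inner :: "'a measure \<Rightarrow> ('a \<Rightarrow> complex) \<Rightarrow> ('a \<Rightarrow> complex) \<Rightarrow> complex" where
  "L2_inner M f g = (\<integral>x. f x * cnj (g x) \<partial>M)"

definition L2_norm :: "'a measure \<Rightarrow> ('a \<Rightarrow> complex) \<Rightarrow> real" where
  "L2_norm M f = sqrt (\<integral>x. (cmod (f x))\<^sup>2 \<partial>M)"

interpretation cfun: vector_space "\<lambda>(c::complex) (f::'a \<Rightarrow> complex) x. c * f x"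
  by standard (auto simp: fun_eq_iff algebra_simps)

definition closed_span :: "'a measure \<Rightarrow> ('a \<Rightarrow> complex) set \<Rightarrow> ('a \<Rightarrow> complex) set" where
  "closed_span M A = {f \<in> L2 M. \<forall>e>0. \<exists>g\<in>cfun.span A. L2_norm M (f - g) < e}"

definition orthogonal_sets :: "'a measure \<Rightarrow> ('a \<Rightarrow> complex) set \<Rightarrow> ('a \<Rightarrow> complex) set \<Rightarrow> bool" where
  "orthogonal_sets M A B \<longleftrightarrow> (\<forall>f\<in>A. \<forall>g\<in>B. L2_inner M f g = 0)"


section \<open>The operators \<open>S\<^sub>i\<close> and the subspaces they generate\<close>

definition S_op :: "nat \<Rightarrow> (nat \<Rightarrow> real) \<Rightarrow> nat \<Rightarrow> ((nat \<Rightarrow> nat) \<Rightarrow> complex) \<Rightarrow> (nat \<Rightarrow> nat) \<Rightarrow> complex" where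
  "S_op N p i f = (\<lambda>x. indicator (cylinder N [i]) x * of_real (p i powr (-1/2)) * f (seq_shift x))"

definition S_word :: "nat \<Rightarrow> (nat \<Rightarrow> real) \<Rightarrow> nat list \<Rightarrow> ((nat \<Rightarrow> nat) \<Rightarrow> complex) \<Rightarrow> (nat \<Rightarrow> nat) \<Rightarrow> complex" where
  "S_word N p w f = foldr (S_op N p) w f"

definition scaling_space ::
  "nat \<Rightarrow> (nat \<Rightarrow> nat) measure \<Rightarrow> (nat \<Rightarrow> (nat \<Rightarrow> nat) \<Rightarrow> complex) \<Rightarrow> ((nat \<Rightarrow> nat) \<Rightarrow> complex) set" where
  "scaling_space N M \<phi> = closed_span M {\<phi> k | k. k < N}"

text \<open>For \<open>n = 0\<close> the only word is the empty one and \<open>S_word N p [] f = f\<close>.\<close>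

definition wavelet_space ::
  "nat \<Rightarrow> (nat \<Rightarrow> real) \<Rightarrow> (nat \<Rightarrow> nat) measure \<Rightarrow> (nat \<Rightarrow> nat \<Rightarrow> (nat \<Rightarrow> nat) \<Rightarrow> complex) \<Rightarrow> nat
     \<Rightarrow> ((nat \<Rightarrow> nat) \<Rightarrow> complex) set" where
  "wavelet_space N p M \<psi> n =
     closed_span M {S_word N p w (\<psi> j k) | w j k. k < N \<and> 1 \<le> j \<and> j \<le> N - 1 \<and> w \<in> words N n}"


section \<open>Well-definedness: the measure exists and is unique, and each \<open>S\<^sub>i\<close> is an isometry\<close>

lemma cantor_space_eq: "cantor_space N = {x. \<forall>j. x j < N}"
  by (auto simp: cantor_space_def cantor_top_def PiE_def Pi_def)

lemma mem_cylinder_map: "x \<in> cantor_space N \<Longrightarrow> x \<in> cylinder N (map x [0..<n])"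
  by (auto simp: cylinder_def)

lemma cylinder_Nil: "cylinder N [] = cantor_space N"
  by (auto simp: cylinder_def)

lemma words_map: "x \<in> cantor_space N \<Longrightarrow> map x [0..<n] \<in> words N n"
  by (auto simp: words_def cantor_space_eq)

lemma openin_cylinder: "openin (cantor_top N) (cylinder N w)"
proof -
  have eq: "cylinder N w = Pi\<^sub>E UNIV (\<lambda>j. {i. i < N \<and> (j < length w \<longrightarrow> i = w ! j)})"
    by (auto simp: cylinder_def cantor_space_eq PiE_def Pi_def)
  have "finite {j. {i. i < N \<and> (j < length w \<longrightarrow> i = w ! j)} \<noteq> {..<N}}"
    by (rule finite_subset[of _ "{..<length w}"]) auto
  then show ?thesis
    unfolding eq cantor_top_def by (intro product_topology_basis) auto
qed

lemma open_contains_cylinder: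
  assumes "openin (cantor_top N) U" "x \<in> U"
  shows "\<exists>n. cylinder N (map x [0..<n]) \<subseteq> U"
proof -
  obtain V where V: "finite {i. V i \<noteq> {..<N}}" "x \<in> Pi\<^sub>E UNIV V" "Pi\<^sub>E UNIV V \<subseteq> U"
    using assms unfolding cantor_top_def openin_product_topology_alt by auto
  obtain n where n: "{i. V i \<noteq> {..<N}} \<subseteq> {..<n}"
    using V(1) by (meson finite_nat_bounded)
  have "cylinder N (map x [0..<n]) \<subseteq> Pi\<^sub>E UNIV V"
  proof
    fix y assume y: "y \<in> cylinder N (map x [0..<n])"
    have "y i \<in> V i" for i
    proof (cases "i < n")
      case True
      with y V(2) show ?thesis by (auto simp: cylinder_def PiE_def Pi_def)
    next
      case False
      then have "V i = {..<N}" using n by auto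
      with y show ?thesis by (auto simp: cylinder_def cantor_space_eq)
    qed
    then show "y \<in> Pi\<^sub>E UNIV V" by auto
  qed
  with V(3) show ?thesis by blast
qed

definition cylinders :: "nat \<Rightarrow> (nat \<Rightarrow> nat) set set" where
  "cylinders N = insert {} {cylinder N w | w n. w \<in> words N n}"

lemma cylinders_subset: "cylinders N \<subseteq> Pow (cantor_space N)"
  by (auto simp: cylinders_def cylinder_def)

lemma Int_stable_cylinders: "Int_stable (cylinders N)"
proof (rule Int_stableI)
  have *: "cylinder N v \<inter> cylinder N w \<in> cylinders N"
    if v: "v \<in> words N m" and w: "w \<in> words N n" and "m \<le> n" for v w m n
  proof (cases "cylinder N v \<inter> cylinder N w = {}")
    case True
    then show ?thesis by (simp add: cylinders_def)
  next
    case False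
    then obtain x where x: "x \<in> cylinder N v" "x \<in> cylinder N w" by blast
    have "v ! j = w ! j" if "j < m" for j
    proof -
      have "x j = v ! j" "x j = w ! j"
        using x v w that \<open>m \<le> n\<close> by (simp_all add: cylinder_def words_def)
      then show ?thesis by simp
    qed
    then have "cylinder N w \<subseteq> cylinder N v"
      using v w \<open>m \<le> n\<close> by (fastforce simp: cylinder_def words_def)
    then have "cylinder N v \<inter> cylinder N w = cylinder N w" by blast
    then show ?thesis using w by (auto simp: cylinders_def)
  qed
  fix A B assume "A \<in> cylinders N" "B \<in> cylinders N"
  then consider "A = {} \<or> B = {}"
    | v w m n where "A = cylinder N v" "B = cylinder N w" "v \<in> words N m" "w \<in> words N n"
    by (auto simp: cylinders_def)
  then show "A \<inter> B \<in> cylinders N"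
  proof cases
    case 1
    then show ?thesis by (auto simp: cylinders_def)
  next
    case 2
    show ?thesis
    proof (cases "m \<le> n")
      case True
      then show ?thesis using *[OF 2(3,4)] 2(1,2) by simp
    next
      case False
      then show ?thesis using *[OF 2(4,3)] 2(1,2) by (simp add: Int_commute)
    qed
  qed
qed

lemma sigma_cylinders:
  "sigma_sets (cantor_space N) {U. openin (cantor_top N) U} = sigma_sets (cantor_space N) (cylinders N)"
proof (intro antisym sigma_sets_mono subsetI)
  fix U assume "U \<in> {U. openin (cantor_top N) U}"
  then have U: "openin (cantor_top N) U" by simp
  then have sub: "U \<subseteq> cantor_space N"
    using openin_subset by (auto simp: cantor_space_def)
  let ?W = "{w. (\<exists>n. w \<in> words N n) \<and> cylinder N w \<subseteq> U}"
  have "U = (\<Union>w\<in>?W. cylinder N w)"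
  proof (intro antisym subsetI)
    fix x assume x: "x \<in> U"
    then obtain n where n: "cylinder N (map x [0..<n]) \<subseteq> U"
      using open_contains_cylinder[OF U] by blast
    have "x \<in> cantor_space N" using x sub by blast
    then have "map x [0..<n] \<in> ?W" "x \<in> cylinder N (map x [0..<n])"
      using n words_map[of x N n] mem_cylinder_map[of x N n] by auto
    then show "x \<in> (\<Union>w\<in>?W. cylinder N w)" by blast
  qed auto
  moreover have "(\<Union>w\<in>?W. cylinder N w) \<in> sigma_sets (cantor_space N) (cylinders N)"
  proof (rule sigma_sets_UNION)
    show "countable (cylinder N ` ?W)" by (intro countable_image countableI_type)
    show "b \<in> sigma_sets (cantor_space N) (cylinders N)" if "b \<in> cylinder N ` ?W" for b
      using that by (auto simp: cylinders_def intro!: sigma_sets.Basic)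
  qed
  ultimately show "U \<in> sigma_sets (cantor_space N) (cylinders N)" by simp
next
  fix A assume "A \<in> cylinders N"
  then show "A \<in> sigma_sets (cantor_space N) {U. openin (cantor_top N) U}"
    using openin_cylinder by (auto simp: cylinders_def intro: sigma_sets.Empty)
qed

lemma sets_markov: "markov_measure N p M \<Longrightarrow> sets M = sigma_sets (cantor_space N) (cylinders N)"
  by (simp add: markov_measure_def sigma_cylinders)

lemma cylinder_in_sets: "markov_measure N p M \<Longrightarrow> cylinder N w \<in> sets M"
  using openin_cylinder[of N w] by (auto simp: markov_measure_def)

lemma measure_cylinder:
  assumes "markov_measure N p M" "w \<in> words N n"
  shows "measure M (cylinder N w) = (\<Prod>j<n. p (w ! j))"
proof (cases "n = 0")
  case True
  with assms have "cylinder N w = space M"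
    by (auto simp: words_def cylinder_Nil markov_measure_def)
  moreover have "measure M (space M) = 1"
    using assms(1) by (intro prob_space.prob_space) (simp add: markov_measure_def)
  ultimately show ?thesis using True by simp
next
  case False
  with assms show ?thesis by (auto simp: markov_measure_def)
qed

lemma measure_eq_on_cylinders:
  assumes M: "markov_measure N p M" and sets: "sets M' = sets M"
    and eq: "\<And>n w. w \<in> words N n \<Longrightarrow> emeasure M' (cylinder N w) = ennreal (\<Prod>j<n. p (w ! j))"
  shows "M = M'"
proof (rule measure_eqI_generator_eq[OF Int_stable_cylinders cylinders_subset,
      where A = "\<lambda>_. cantor_space N"])
  interpret prob_space M using M by (simp add: markov_measure_def)
  show "emeasure M X = emeasure M' X" if "X \<in> cylinders N" for X
    using that eq measure_cylinder[OF M] by (auto simp: cylinders_def emeasure_eq_measure)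
  show "sets M = sigma_sets (cantor_space N) (cylinders N)" by (rule sets_markov[OF M])
  then show "sets M' = sigma_sets (cantor_space N) (cylinders N)" using sets by simp
  have "cylinder N [] \<in> cylinders N" by (auto simp: cylinders_def words_def)
  then show "range (\<lambda>_. cantor_space N) \<subseteq> cylinders N" by (simp add: cylinder_Nil image_subset_iff)
qed (use M in \<open>auto simp: markov_measure_def prob_space_def finite_measure.emeasure_finite\<close>)

lemma markov_measure_unique:
  assumes "markov_measure N p M" "markov_measure N p M'"
  shows "M = M'"
proof (rule measure_eq_on_cylinders[OF assms(1)])
  interpret prob_space M' using assms(2) by (simp add: markov_measure_def)
  show "sets M' = sets M" using assms by (simp add: markov_measure_def)
  show "emeasure M' (cylinder N w) = ennreal (\<Prod>j<n. p (w ! j))" if "w \<in> words N n" for n w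
    using measure_cylinder[OF assms(2) that] by (simp add: emeasure_eq_measure)
qed

lemma markov_measure_exists:
  assumes p: "\<And>i. i < N \<Longrightarrow> 0 < p i" and sum: "(\<Sum>i<N. p i) = 1"
  shows "\<exists>M. markov_measure N p M"
proof -
  define P where "P = point_measure {..<N} (\<lambda>i. ennreal (p i))"
  have "(\<Sum>i<N. ennreal (p i)) = ennreal (\<Sum>i<N. p i)"
    using p by (intro sum_ennreal) (auto intro: less_imp_le)
  then have "emeasure P (space P) = 1"
    using sum unfolding P_def space_point_measure by (simp add: emeasure_point_measure_finite)
  then interpret letter: prob_space P by (rule prob_spaceI)
  interpret product_prob_space "\<lambda>_::nat. P" UNIV by unfold_locales
  let ?M = "PiM (UNIV::nat set) (\<lambda>_. P)"
  have space: "space ?M = cantor_space N"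
    by (auto simp: space_PiM P_def space_point_measure cantor_space_eq PiE_def Pi_def)
  have cyl: "cylinder N w = {x \<in> space ?M. \<forall>j\<in>{..<length w}. x j \<in> {w ! j}}" for w
    by (auto simp: cylinder_def space)
  have cyl_sets: "cylinder N w \<in> sets ?M" if "w \<in> words N n" for n w
  proof -
    have *: "{x \<in> space ?M. x j \<in> {w ! j}} \<in> sets ?M" if "j < length w" for j
      using that \<open>w \<in> words N n\<close>
      by (intro sets_Collect_single') (auto simp: P_def space_point_measure sets_point_measure words_def)
    show ?thesis unfolding cyl using * by (intro sets.sets_Collect_finite_All) auto
  qed
  have sets: "sets ?M = sigma_sets (cantor_space N) {U. openin (cantor_top N) U}"
  proof (intro antisym)
    show "sets ?M \<subseteq> sigma_sets (cantor_space N) {U. openin (cantor_top N) U}"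
      unfolding sets_PiM_single space[symmetric] space_PiM[symmetric]
    proof (intro sigma_sets_mono subsetI)
      fix A assume "A \<in> {{f \<in> space ?M. f i \<in> A} | i A. i \<in> UNIV \<and> A \<in> sets P}"
      then obtain i B where A: "A = {f \<in> space ?M. f i \<in> B}" "B \<subseteq> {..<N}"
        by (auto simp: P_def sets_point_measure)
      have "openin (cantor_top N) A"
        using openin_continuous_map_preimage[OF continuous_map_product_projection[of i UNIV "\<lambda>_. discrete_topology {..<N}"], of B] A
        by (simp add: cantor_top_def[symmetric] space cantor_space_def)
      then show "A \<in> sigma_sets (space ?M) {U. openin (cantor_top N) U}" by auto
    qed
    show "sigma_sets (cantor_space N) {U. openin (cantor_top N) U} \<subseteq> sets ?M"
      unfolding sigma_cylinders unfolding space[symmetric]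
      by (rule sets.sigma_sets_subset) (auto simp: cylinders_def cyl_sets)
  qed
  have "measure ?M (cylinder N w) = (\<Prod>j<n. p (w ! j))" if w: "w \<in> words N n" for n w
  proof -
    have wj: "w ! j < N" if "j < n" for j using w that nth_mem[of j w] by (force simp: words_def)
    have "emeasure ?M (cylinder N w) = (\<Prod>j<n. emeasure P {w ! j})"
      unfolding cyl using w wj
      by (subst emeasure_PiM_Collect) (auto simp: P_def sets_point_measure words_def)
    also have "\<dots> = (\<Prod>j<n. ennreal (p (w ! j)))"
      using wj by (intro prod.cong) (auto simp: P_def emeasure_point_measure_finite)
    also have "\<dots> = ennreal (\<Prod>j<n. p (w ! j))"
      using wj p by (intro prod_ennreal) (auto intro: less_imp_le)
    finally have "emeasure ?M (cylinder N w) = ennreal (\<Prod>j<n. p (w ! j))" .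
    moreover have "0 \<le> (\<Prod>j<n. p (w ! j))"
      using wj p by (intro prod_nonneg) (auto intro: less_imp_le)
    ultimately show ?thesis by (simp add: measure_def)
  qed
  then have "markov_measure N p ?M"
    by (auto simp: markov_measure_def space sets intro: prob_space_axioms)
  then show ?thesis by blast
qed

lemma shift_vimage_cylinder:
  assumes "i < N" "w \<in> words N n"
  shows "{x \<in> cylinder N [i]. seq_shift x \<in> cylinder N w} = cylinder N (i # w)"
proof (intro set_eqI)
  fix x
  show "x \<in> {x \<in> cylinder N [i]. seq_shift x \<in> cylinder N w} \<longleftrightarrow> x \<in> cylinder N (i # w)"
    by (auto simp: cylinder_def cantor_space_eq seq_shift_def nth_Cons split: nat.splits)
qed

lemma shift_vimage_cylinder_sets:
  assumes M: "markov_measure N p M" and w: "w \<in> words N n"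
  shows "{x \<in> space M. seq_shift x \<in> cylinder N w} \<in> sets M"
proof -
  have "{x \<in> space M. seq_shift x \<in> cylinder N w} = (\<Union>i<N. cylinder N (i # w))"
    using M w
    by (auto simp: markov_measure_def cylinder_def cantor_space_eq seq_shift_def nth_Cons split: nat.splits)
  then show ?thesis using cylinder_in_sets[OF M] by auto
qed

lemma measurable_shift:
  assumes M: "markov_measure N p M"
  shows "seq_shift \<in> measurable M M"
proof (rule measurable_sigma_sets[OF sets_markov[OF M] cylinders_subset])
  show "seq_shift \<in> space M \<rightarrow> cantor_space N"
    using M by (auto simp: markov_measure_def cantor_space_eq seq_shift_def)
  show "seq_shift -` A \<inter> space M \<in> sets M" if "A \<in> cylinders N" for A
  proof (cases "A = {}")
    case False
    with that obtain w n where "A = cylinder N w" "w \<in> words N n" by (auto simp: cylinders_def)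
    then show ?thesis
      using shift_vimage_cylinder_sets[OF M, of w n] by (simp add: vimage_def Int_def conj_commute)
  qed simp
qed

lemma distr_density_shift:
  assumes M: "markov_measure N p M" and p: "0 < p i" and i: "i < N"
  shows "M = distr (density M (\<lambda>x. ennreal (indicator (cylinder N [i]) x / p i))) M seq_shift"
    (is "_ = distr ?D M seq_shift")
proof (rule measure_eq_on_cylinders[OF M])
  interpret prob_space M using M by (simp add: markov_measure_def)
  note [measurable] = measurable_shift[OF M] cylinder_in_sets[OF M]
  show "emeasure (distr ?D M seq_shift) (cylinder N w) = ennreal (\<Prod>j<n. p (w ! j))"
    if w: "w \<in> words N n" for n w
  proof -
    have iw: "i # w \<in> words N (Suc n)" using w i by (auto simp: words_def)
    have "emeasure (distr ?D M seq_shift) (cylinder N w) = emeasure ?D (seq_shift -` cylinder N w \<inter> space M)"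
      by (subst emeasure_distr) auto
    also have "\<dots> = (\<integral>\<^sup>+x. ennreal (indicator (cylinder N [i]) x / p i)
                       * indicator (seq_shift -` cylinder N w \<inter> space M) x \<partial>M)"
      by (rule emeasure_density) (measurable)
    also have "\<dots> = (\<integral>\<^sup>+x. ennreal (1 / p i) * indicator (cylinder N (i # w)) x \<partial>M)"
      by (intro nn_integral_cong)
        (auto simp: shift_vimage_cylinder[OF i w, symmetric] split: split_indicator)
    also have "\<dots> = ennreal (1 / p i) * emeasure M (cylinder N (i # w))"
      by (rule nn_integral_cmult_indicator) simp
    also have "\<dots> = ennreal (1 / p i * (\<Prod>j<Suc n. p ((i # w) ! j)))"
      using p by (simp add: emeasure_eq_measure measure_cylinder[OF M iw] ennreal_mult'[symmetric])
    also have "1 / p i * (\<Prod>j<Suc n. p ((i # w) ! j)) = (\<Prod>j<n. p (w ! j))"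
      using p by (subst prod.lessThan_Suc_shift) simp
    finally show ?thesis .
  qed
qed simp

lemma measurable_S_op:
  assumes M: "markov_measure N p M" and f: "f \<in> borel_measurable M"
  shows "S_op N p i f \<in> borel_measurable M"
proof -
  note [measurable] = measurable_shift[OF M] cylinder_in_sets[OF M] f
  show ?thesis unfolding S_op_def by measurable
qed

lemma S_op_L2:
  assumes M: "markov_measure N p M" and p: "0 < p i" and i: "i < N" and f: "f \<in> L2 M"
  shows "S_op N p i f \<in> L2 M" and "L2_norm M (S_op N p i f) = L2_norm M f"
proof -
  have f': "f \<in> borel_measurable M" using f by (simp add: L2_def)
  note [measurable] = measurable_shift[OF M] cylinder_in_sets[OF M] f'
  let ?d = "\<lambda>x. indicator (cylinder N [i]) x / p i :: real"
  let ?D = "density M (\<lambda>x. ennreal (?d x))"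
  have sq: "(cmod (S_op N p i f x))\<^sup>2 = ?d x *\<^sub>R (cmod (f (seq_shift x)))\<^sup>2" for x
  proof -
    have "(p i powr (-1/2))\<^sup>2 = 1 / p i"
      using p by (simp add: power2_eq_square powr_add[symmetric] powr_minus_divide)
    then show ?thesis
      using p by (auto simp: S_op_def norm_mult power_mult_distrib split: split_indicator)
  qed
  have D: "distr ?D M seq_shift = M"
    using distr_density_shift[where p = p, OF M p i] by simp
  have d: "AE x in M. 0 \<le> ?d x" using p by auto
  have "integrable M (\<lambda>x. (cmod (f x))\<^sup>2)" using f by (simp add: L2_def)
  then have "integrable (distr ?D M seq_shift) (\<lambda>x. (cmod (f x))\<^sup>2)" unfolding D .
  then have "integrable ?D (\<lambda>x. (cmod (f (seq_shift x)))\<^sup>2)" by (subst (asm) integrable_distr_eq) auto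
  then have "integrable M (\<lambda>x. ?d x *\<^sub>R (cmod (f (seq_shift x)))\<^sup>2)"
    using d by (subst (asm) integrable_density) auto
  then show "S_op N p i f \<in> L2 M"
    unfolding L2_def sq[symmetric] using measurable_S_op[OF M f'] by simp
  have "(\<integral>x. (cmod (f x))\<^sup>2 \<partial>M) = (\<integral>x. (cmod (f x))\<^sup>2 \<partial>distr ?D M seq_shift)" unfolding D ..
  also have "\<dots> = (\<integral>x. (cmod (f (seq_shift x)))\<^sup>2 \<partial>?D)" by (subst integral_distr) auto
  also have "\<dots> = (\<integral>x. ?d x *\<^sub>R (cmod (f (seq_shift x)))\<^sup>2 \<partial>M)"
    using d by (subst integral_density) auto
  finally show "L2_norm M (S_op N p i f) = L2_norm M f"
    unfolding L2_norm_def sq by simp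
qed

lemma S_op_cong_AE:
  assumes M: "markov_measure N p M" and p: "0 < p i" and i: "i < N"
    and eq: "AE x in M. f x = g x"
  shows "AE x in M. S_op N p i f x = S_op N p i g x"
proof -
  note [measurable] = measurable_shift[OF M] cylinder_in_sets[OF M]
  let ?D = "density M (\<lambda>x. ennreal (indicator (cylinder N [i]) x / p i))"
  have D: "distr ?D M seq_shift = M"
    using distr_density_shift[where p = p, OF M p i] by simp
  have "AE x in distr ?D M seq_shift. f x = g x" unfolding D by (rule eq)
  then have "AE x in ?D. f (seq_shift x) = g (seq_shift x)" by (rule AE_distrD[rotated]) simp
  then have "AE x in M. 0 < ennreal (indicator (cylinder N [i]) x / p i) \<longrightarrow> f (seq_shift x) = g (seq_shift x)"
    by (subst (asm) AE_density) auto
  then show ?thesis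
    using p by (auto simp: S_op_def elim!: eventually_mono split: split_indicator)
qed

lemma S_op_linear:
  "S_op N p i (f + g) = S_op N p i f + S_op N p i g"
  "S_op N p i (\<lambda>x. c * f x) = (\<lambda>x. c * S_op N p i f x)"
  by (auto simp: S_op_def fun_eq_iff algebra_simps)

end

theory Submission
  imports Defs
begin

text \<open>
  Write \<open>\<chi>\<^sub>v\<close> for the indicator function of the cylinder \<open>Z(v)\<close>. The construction is a Haar-type
  multiresolution of the Cantor set: take
  \[ \phi_k = \chi_{k}, \qquad \psi_{j,k} = \chi_{kj} - p_j \, \chi_{k} . \]
  Passing from words of length \<open>n\<close> to words of length \<open>n + 1\<close> refines the functions that are constant on
  cylinders, and \<open>\<psi>\<^sub>j\<^sub>,\<^sub>k\<close> is what the refinement adds at \<open>Z(k)\<close>: since \<open>\<mu>(Z(kj)) = p\<^sub>j \<mu>(Z(k))\<close>, the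
  number \<open>p\<^sub>j\<close> is exactly the mean of \<open>\<chi>\<^sub>k\<^sub>j\<close> over \<open>Z(k)\<close>. The index \<open>j = 0\<close> is left out because the \<open>N\<close> children of
  a cylinder partition it, which makes \<open>\<chi>\<^sub>k\<^sub>0\<close> recoverable from \<open>\<chi>\<^sub>k\<close> and the other children.

  The operators act on cylinders by prefixing letters, so up to a nonzero factor \<open>S\<^sub>w \<psi>\<^sub>j\<^sub>,\<^sub>k\<close> is again such a
  difference, now located at the word \<open>wk\<close> (\<open>S_word_detail\<close>). Two facts then give the theorem.

  Orthogonality: the difference at a word \<open>v\<close> lives on \<open>Z(v)\<close> and has mean zero there, while \<open>\<chi>\<^sub>u\<close> is constant on
  \<open>Z(v)\<close> as soon as \<open>u\<close> is not longer than \<open>v\<close> (\<open>detail_orthogonal_cyl_fun\<close>). The generators of the scaling space and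
  of the coarser wavelet spaces are combinations of such \<open>\<chi>\<^sub>u\<close>, and the Cauchy-Schwarz inequality carries
  orthogonality over from generators to closed spans (\<open>orthogonal_closed_spans\<close>).

  Completeness: by induction on the length, every \<open>\<chi>\<^sub>v\<close> is a finite combination of scaling functions and wavelets.
  Cylinders are stable under intersection and generate the \<open>\<sigma>\<close>-algebra, so a Dynkin argument followed by
  approximation with simple functions shows that the closed span is all of \<open>L\<^sup>2\<close> (\<open>L2_eq_closed_span\<close>).
\<close>

section \<open>The seminormed space of square-integrable functions\<close>

lemma L2_measurable: "f \<in> L2 M \<Longrightarrow> f \<in> borel_measurable M"
  by (simp add: L2_def)

lemma borel_measurable_cnj [measurable]: "cnj \<in> borel_measurable borel"
  by (intro borel_measurable_continuous_onI continuous_intros)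

lemma L2_integrable_prod:
  assumes f: "f \<in> L2 M" and g: "g \<in> L2 M"
  shows "integrable M (\<lambda>x. f x * cnj (g x))"
proof -
  note [measurable] = L2_measurable[OF f] L2_measurable[OF g]
  have bound: "cmod (f x * cnj (g x)) \<le> (cmod (f x))\<^sup>2 + (cmod (g x))\<^sup>2" for x
    using sum_squares_bound[of "cmod (f x)" "cmod (g x)"] mult_nonneg_nonneg[of "cmod (f x)" "cmod (g x)"]
    unfolding norm_mult complex_mod_cnj by (simp del: mult_nonneg_nonneg zero_le_mult_iff)
  have "integrable M (\<lambda>x. (cmod (f x))\<^sup>2 + (cmod (g x))\<^sup>2)"
    using f g by (simp add: L2_def)
  then show ?thesis
    by (rule Bochner_Integration.integrable_bound) (use bound in \<open>auto intro: order_trans[OF _ abs_ge_self]\<close>)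
qed

lemma L2_add:
  assumes f: "f \<in> L2 M" and g: "g \<in> L2 M"
  shows "f + g \<in> L2 M"
proof -
  note [measurable] = L2_measurable[OF f] L2_measurable[OF g]
  have bound: "(cmod (f x + g x))\<^sup>2 \<le> 2 * (cmod (f x))\<^sup>2 + 2 * (cmod (g x))\<^sup>2" for x
  proof -
    have "(cmod (f x + g x))\<^sup>2 \<le> (cmod (f x) + cmod (g x))\<^sup>2"
      by (intro power_mono norm_triangle_ineq) simp
    also have "\<dots> \<le> 2 * (cmod (f x))\<^sup>2 + 2 * (cmod (g x))\<^sup>2"
      using sum_squares_bound[of "cmod (f x)" "cmod (g x)"] by (simp add: power2_sum)
    finally show ?thesis .
  qed
  have "integrable M (\<lambda>x. 2 * (cmod (f x))\<^sup>2 + 2 * (cmod (g x))\<^sup>2)"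
    using f g by (simp add: L2_def)
  then have "integrable M (\<lambda>x. (cmod (f x + g x))\<^sup>2)"
    by (rule Bochner_Integration.integrable_bound) (use bound in \<open>auto intro: order_trans[OF _ abs_ge_self]\<close>)
  then show ?thesis by (simp add: L2_def plus_fun_def)
qed

lemma L2_scale: "f \<in> L2 M \<Longrightarrow> (\<lambda>x. c * f x) \<in> L2 M"
  by (auto simp: L2_def norm_mult power_mult_distrib)

lemma L2_subspace: "cfun.subspace (L2 M)"
  by (rule cfun.subspaceI) (auto simp: L2_add L2_scale, simp add: L2_def zero_fun_def)

lemma L2_diff: "f \<in> L2 M \<Longrightarrow> g \<in> L2 M \<Longrightarrow> f - g \<in> L2 M"
  using cfun.subspace_diff[OF L2_subspace] .

lemma (in finite_measure) L2_indicator: "A \<in> sets M \<Longrightarrow> indicator A \<in> L2 M"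
proof -
  assume A: "A \<in> sets M"
  have "(\<lambda>x. (cmod (indicator A x))\<^sup>2) = (indicator A :: _ \<Rightarrow> real)"
    by (auto simp: fun_eq_iff split: split_indicator)
  then show ?thesis using A by (simp add: L2_def emeasure_eq_measure)
qed

lemma L2_inner_commute: "L2_inner M g f = cnj (L2_inner M f g)"
proof -
  have "L2_inner M g f = (\<integral>x. cnj (f x * cnj (g x)) \<partial>M)"
    by (simp add: L2_inner_def mult.commute)
  then show ?thesis by (simp only: L2_inner_def Bochner_Integration.integral_cnj)
qed

lemma L2_inner_add:
  assumes "f \<in> L2 M" "g \<in> L2 M" "h \<in> L2 M"
  shows "L2_inner M (f + g) h = L2_inner M f h + L2_inner M g h"
  using L2_integrable_prod[OF assms(1,3)] L2_integrable_prod[OF assms(2,3)]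
  by (simp add: L2_inner_def distrib_right)

lemma L2_inner_scale: "L2_inner M (\<lambda>x. c * f x) h = c * L2_inner M f h"
  by (simp add: L2_inner_def mult.assoc)

lemma L2_inner_diff:
  assumes "f \<in> L2 M" "g \<in> L2 M" "h \<in> L2 M"
  shows "L2_inner M (f - g) h = L2_inner M f h - L2_inner M g h"
  using L2_integrable_prod[OF assms(1,3)] L2_integrable_prod[OF assms(2,3)]
  by (simp add: L2_inner_def left_diff_distrib)

lemma L2_norm_sq: "(L2_norm M f)\<^sup>2 = (\<integral>x. (cmod (f x))\<^sup>2 \<partial>M)"
  by (simp add: L2_norm_def)

lemma L2_norm_nonneg: "0 \<le> L2_norm M f"
  by (simp add: L2_norm_def)

lemma L2_norm_scale: "L2_norm M (\<lambda>x. c * f x) = cmod c * L2_norm M f"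
  by (simp add: L2_norm_def norm_mult power_mult_distrib real_sqrt_mult)

text \<open>
  Moduli are taken inside the integral because this form yields both the bound on the inner product and the
  triangle inequality.
\<close>

lemma L2_Cauchy_Schwarz_abs:
  assumes f: "f \<in> L2 M" and g: "g \<in> L2 M"
  shows "(\<integral>x. cmod (f x) * cmod (g x) \<partial>M) \<le> L2_norm M f * L2_norm M g"
proof -
  note [measurable] = L2_measurable[OF f] L2_measurable[OF g]
  have int: "integrable M (\<lambda>x. cmod (f x) * cmod (g x))"
    using integrable_norm[OF L2_integrable_prod[OF f g]] by (simp add: norm_mult)
  let ?I = "\<integral>x. cmod (f x) * cmod (g x) \<partial>M"
  have "ennreal (?I\<^sup>2) = (\<integral>\<^sup>+x. ennreal (cmod (f x)) * ennreal (cmod (g x)) \<partial>M)\<^sup>2"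
    using nn_integral_eq_integral[OF int] by (simp add: ennreal_mult ennreal_power)
  also have "\<dots> \<le> (\<integral>\<^sup>+x. (ennreal (cmod (f x)))\<^sup>2 \<partial>M) * (\<integral>\<^sup>+x. (ennreal (cmod (g x)))\<^sup>2 \<partial>M)"
    by (rule Cauchy_Schwarz_nn_integral) auto
  also have "\<dots> = ennreal ((L2_norm M f * L2_norm M g)\<^sup>2)"
    using f g nn_integral_eq_integral[of M "\<lambda>x. (cmod (f x))\<^sup>2"] nn_integral_eq_integral[of M "\<lambda>x. (cmod (g x))\<^sup>2"]
    by (simp add: L2_def ennreal_power power_mult_distrib L2_norm_sq ennreal_mult)
  finally have "?I\<^sup>2 \<le> (L2_norm M f * L2_norm M g)\<^sup>2" by simp
  then show ?thesis by (rule power2_le_imp_le) (simp add: L2_norm_nonneg)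
qed

lemma L2_Cauchy_Schwarz:
  assumes "f \<in> L2 M" "g \<in> L2 M"
  shows "cmod (L2_inner M f g) \<le> L2_norm M f * L2_norm M g"
  using integral_norm_bound[of M "\<lambda>x. f x * cnj (g x)"] L2_Cauchy_Schwarz_abs[OF assms]
  by (simp add: L2_inner_def norm_mult)

lemma L2_norm_triangle:
  assumes f: "f \<in> L2 M" and g: "g \<in> L2 M"
  shows "L2_norm M (f + g) \<le> L2_norm M f + L2_norm M g"
proof (rule power2_le_imp_le)
  have int: "integrable M (\<lambda>x. cmod (f x) * cmod (g x))"
    using integrable_norm[OF L2_integrable_prod[OF f g]] by (simp add: norm_mult)
  have "(L2_norm M (f + g))\<^sup>2 \<le> (\<integral>x. (cmod (f x))\<^sup>2 + (cmod (g x))\<^sup>2 + 2 * (cmod (f x) * cmod (g x)) \<partial>M)"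
    unfolding L2_norm_sq
  proof (rule integral_mono)
    show "integrable M (\<lambda>x. (cmod ((f + g) x))\<^sup>2)" using L2_add[OF f g] by (simp add: L2_def)
    show "integrable M (\<lambda>x. (cmod (f x))\<^sup>2 + (cmod (g x))\<^sup>2 + 2 * (cmod (f x) * cmod (g x)))"
      using f g int by (simp add: L2_def)
    show "(cmod ((f + g) x))\<^sup>2 \<le> (cmod (f x))\<^sup>2 + (cmod (g x))\<^sup>2 + 2 * (cmod (f x) * cmod (g x))" for x
      using power_mono[OF norm_triangle_ineq[of "f x" "g x"], of 2] by (simp add: power2_sum algebra_simps)
  qed
  also have "\<dots> = (L2_norm M f)\<^sup>2 + (L2_norm M g)\<^sup>2 + 2 * (\<integral>x. cmod (f x) * cmod (g x) \<partial>M)"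
    using f g int by (simp add: L2_def L2_norm_sq)
  also have "\<dots> \<le> (L2_norm M f + L2_norm M g)\<^sup>2"
    using L2_Cauchy_Schwarz_abs[OF f g] by (simp add: power2_sum)
  finally show "(L2_norm M (f + g))\<^sup>2 \<le> (L2_norm M f + L2_norm M g)\<^sup>2" .
qed (simp add: L2_norm_nonneg)

section \<open>Closed linear spans\<close>

lemma span_L2: "A \<subseteq> L2 M \<Longrightarrow> cfun.span A \<subseteq> L2 M"
  by (rule cfun.span_minimal[OF _ L2_subspace])

lemma closed_span_subset_L2: "closed_span M A \<subseteq> L2 M"
  by (auto simp: closed_span_def)

lemma span_subset_closed_span:
  assumes "A \<subseteq> L2 M" shows "cfun.span A \<subseteq> closed_span M A"
proof
  fix f assume f: "f \<in> cfun.span A"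
  have "L2_norm M (f - f) = 0" by (simp add: L2_norm_def)
  then show "f \<in> closed_span M A"
    using f span_L2[OF assms] unfolding closed_span_def by (force intro!: bexI[of _ f])
qed

lemma closed_span_superset: "A \<subseteq> L2 M \<Longrightarrow> A \<subseteq> closed_span M A"
  using span_subset_closed_span cfun.span_superset by blast

lemma closed_span_subspace:
  assumes A: "A \<subseteq> L2 M" shows "cfun.subspace (closed_span M A)"
proof (rule cfun.subspaceI)
  note L2 = subsetD[OF span_L2[OF A]] subsetD[OF closed_span_subset_L2]
  show "0 \<in> closed_span M A"
    using span_subset_closed_span[OF A] cfun.span_zero by blast
  fix f g and c :: complex
  assume f: "f \<in> closed_span M A" and g: "g \<in> closed_span M A"
  show "f + g \<in> closed_span M A"
    unfolding closed_span_def
  proof (intro CollectI conjI allI impI)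
    show "f + g \<in> L2 M" using f g L2_add L2(2) by blast
    fix e :: real assume "e > 0"
    then have "e / 2 > 0" by simp
    then obtain f' g' where f': "f' \<in> cfun.span A" "L2_norm M (f - f') < e / 2"
      and g': "g' \<in> cfun.span A" "L2_norm M (g - g') < e / 2"
      using f g unfolding closed_span_def by blast
    have "L2_norm M (f + g - (f' + g')) = L2_norm M ((f - f') + (g - g'))"
      by (simp add: algebra_simps)
    also have "\<dots> \<le> L2_norm M (f - f') + L2_norm M (g - g')"
      using L2(1)[OF f'(1)] L2(1)[OF g'(1)] L2(2)[OF f] L2(2)[OF g]
      by (intro L2_norm_triangle L2_diff)
    finally show "\<exists>h\<in>cfun.span A. L2_norm M (f + g - h) < e"
      using f' g' by (intro bexI[of _ "f' + g'"] cfun.span_add) auto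
  qed
  show "(\<lambda>x. c * f x) \<in> closed_span M A"
    unfolding closed_span_def
  proof (intro CollectI conjI allI impI)
    show "(\<lambda>x. c * f x) \<in> L2 M" using L2(2)[OF f] by (rule L2_scale)
    fix e :: real assume "e > 0"
    then have "e / (cmod c + 1) > 0" by (simp add: add_nonneg_pos)
    then obtain f' where f': "f' \<in> cfun.span A" "L2_norm M (f - f') < e / (cmod c + 1)"
      using f unfolding closed_span_def by blast
    have "(\<lambda>x. c * f x) - (\<lambda>x. c * f' x) = (\<lambda>x. c * (f - f') x)"
      by (simp add: fun_eq_iff right_diff_distrib)
    then have "L2_norm M ((\<lambda>x. c * f x) - (\<lambda>x. c * f' x)) = cmod c * L2_norm M (f - f')"
      by (simp only: L2_norm_scale)
    also have "\<dots> \<le> (cmod c + 1) * L2_norm M (f - f')"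
      by (intro mult_right_mono) (simp_all add: L2_norm_nonneg)
    also have "\<dots> < e"
      using f'(2) by (simp add: pos_less_divide_eq add_nonneg_pos mult.commute)
    finally show "\<exists>h\<in>cfun.span A. L2_norm M ((\<lambda>x. c * f x) - h) < e"
      using cfun.span_scale[OF f'(1)] by blast
  qed
qed

text \<open>
  The definition of the closed span approximates by elements of the linear span only; splitting \<open>e\<close> in halves shows
  that the resulting set is closed, so that limit arguments can be iterated.
\<close>

lemma closed_span_closed:
  assumes A: "A \<subseteq> L2 M" and f: "f \<in> L2 M"
    and approx: "\<And>e. e > 0 \<Longrightarrow> \<exists>g\<in>closed_span M A. L2_norm M (f - g) < e"
  shows "f \<in> closed_span M A"
  unfolding closed_span_def
proof (intro CollectI conjI allI impI f)
  fix e :: real assume "e > 0"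
  then have "e / 2 > 0" by simp
  then obtain g where g: "g \<in> closed_span M A" "L2_norm M (f - g) < e / 2"
    using approx by blast
  then obtain h where h: "h \<in> cfun.span A" "L2_norm M (g - h) < e / 2"
    using \<open>e / 2 > 0\<close> unfolding closed_span_def by blast
  have "g \<in> L2 M" "h \<in> L2 M"
    using g(1) h(1) closed_span_subset_L2 span_L2[OF A] by blast+
  then have "L2_norm M ((f - g) + (g - h)) \<le> L2_norm M (f - g) + L2_norm M (g - h)"
    using f by (intro L2_norm_triangle L2_diff)
  then show "\<exists>h\<in>cfun.span A. L2_norm M (f - h) < e"
    using g h by (intro bexI[of _ h]) auto
qed

text \<open>
  The vectors orthogonal to \<open>g\<close> form a subspace, which therefore contains the linear span of \<open>A\<close>; by the
  Cauchy-Schwarz inequality, approximating \<open>f\<close> from that span makes its inner product with \<open>g\<close> arbitrarily small.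
\<close>

lemma inner_closed_span_zero:
  assumes A: "A \<subseteq> L2 M" and g: "g \<in> L2 M"
    and orth: "\<And>f. f \<in> A \<Longrightarrow> L2_inner M f g = 0"
    and f: "f \<in> closed_span M A"
  shows "L2_inner M f g = 0"
proof (rule ccontr)
  have "cfun.subspace {h \<in> L2 M. L2_inner M h g = 0}"
    using cfun.subspace_0[OF L2_subspace, of M] g
    by (intro cfun.subspaceI) (auto simp: L2_add L2_scale L2_inner_add L2_inner_scale, simp add: L2_inner_def)
  then have span: "cfun.span A \<subseteq> {h \<in> L2 M. L2_inner M h g = 0}"
    using A orth by (intro cfun.span_minimal) auto
  assume "L2_inner M f g \<noteq> 0"
  \<comment> \<open>The summand \<open>1\<close> keeps the tolerance meaningful when \<open>g\<close> has seminorm \<open>0\<close>.\<close>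
  then have "cmod (L2_inner M f g) / (L2_norm M g + 1) > 0"
    by (simp add: add_nonneg_pos L2_norm_nonneg)
  then obtain h where h: "h \<in> cfun.span A" "L2_norm M (f - h) < cmod (L2_inner M f g) / (L2_norm M g + 1)"
    using f unfolding closed_span_def by blast
  have hL2: "h \<in> L2 M" "L2_inner M h g = 0" and fL2: "f \<in> L2 M"
    using h(1) span f closed_span_subset_L2 by blast+
  have "cmod (L2_inner M f g) = cmod (L2_inner M (f - h) g)"
    using hL2 fL2 g by (simp add: L2_inner_diff)
  also have "\<dots> \<le> L2_norm M (f - h) * L2_norm M g"
    using hL2 fL2 g by (intro L2_Cauchy_Schwarz L2_diff)
  also have "\<dots> \<le> L2_norm M (f - h) * (L2_norm M g + 1)"
    by (intro mult_left_mono) (simp_all add: L2_norm_nonneg)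
  also have "\<dots> < cmod (L2_inner M f g)"
    using h(2) by (simp add: pos_less_divide_eq add_nonneg_pos L2_norm_nonneg)
  finally show False by simp
qed

lemma orthogonal_sets_commute: "orthogonal_sets M A B \<longleftrightarrow> orthogonal_sets M B A"
proof -
  have "L2_inner M f g = 0 \<longleftrightarrow> L2_inner M g f = 0" for f g
    by (subst L2_inner_commute) simp
  then show ?thesis by (auto simp: orthogonal_sets_def)
qed

lemma orthogonal_closed_span_left:
  assumes "A \<subseteq> L2 M" "B \<subseteq> L2 M" "orthogonal_sets M A B"
  shows "orthogonal_sets M (closed_span M A) B"
  using assms inner_closed_span_zero[of A M] unfolding orthogonal_sets_def by (meson subsetD)

lemma orthogonal_closed_spans:
  assumes A: "A \<subseteq> L2 M" and B: "B \<subseteq> L2 M" and "orthogonal_sets M A B"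
  shows "orthogonal_sets M (closed_span M A) (closed_span M B)"
  using orthogonal_closed_span_left[OF B closed_span_subset_L2]
    orthogonal_closed_span_left[OF assms] orthogonal_sets_commute by blast

section \<open>Indicators of a generating family span the whole space\<close>

text \<open>
  Dominated convergence for \<open>\<bar>f - s\<^sub>n\<bar>\<^sup>2\<close>. The factor \<open>2\<close> is the one that the standard approximation of a measurable
  function by simple functions provides, so this covers both the countable unions and the simple functions of the
  density theorem below.
\<close>

lemma closed_span_dominated_limit:
  assumes A: "A \<subseteq> L2 M" and f: "f \<in> L2 M"
    and s: "\<And>n::nat. s n \<in> closed_span M A"
    and lim: "\<And>x. x \<in> space M \<Longrightarrow> (\<lambda>n. s n x) \<longlonglongrightarrow> f x"
    and bound: "\<And>n x. x \<in> space M \<Longrightarrow> cmod (s n x) \<le> 2 * cmod (f x)"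
  shows "f \<in> closed_span M A"
proof (rule closed_span_closed[OF A f])
  fix e :: real assume e: "e > 0"
  have [measurable]: "f \<in> borel_measurable M" "s n \<in> borel_measurable M" for n
    using f s closed_span_subset_L2 L2_measurable by blast+
  have "(\<lambda>n. \<integral>x. (cmod (f x - s n x))\<^sup>2 \<partial>M) \<longlonglongrightarrow> (\<integral>x. 0 \<partial>M)"
  \<comment> \<open>\<open>\<bar>f - s\<^sub>n\<bar> \<le> \<bar>f\<bar> + 2 \<bar>f\<bar>\<close>, whence the constant \<open>9 = 3\<^sup>2\<close>.\<close>
  proof (rule integral_dominated_convergence[where w="\<lambda>x. 9 * (cmod (f x))\<^sup>2"])
    show "integrable M (\<lambda>x. 9 * (cmod (f x))\<^sup>2)" using f by (simp add: L2_def)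
    show "AE x in M. (\<lambda>n. (cmod (f x - s n x))\<^sup>2) \<longlonglongrightarrow> 0"
    proof (rule AE_I2)
      fix x assume "x \<in> space M"
      then have "(\<lambda>n. (cmod (f x - s n x))\<^sup>2) \<longlonglongrightarrow> (cmod (f x - f x))\<^sup>2"
        by (intro tendsto_intros lim)
      then show "(\<lambda>n. (cmod (f x - s n x))\<^sup>2) \<longlonglongrightarrow> 0" by simp
    qed
    show "AE x in M. norm ((cmod (f x - s n x))\<^sup>2) \<le> 9 * (cmod (f x))\<^sup>2" for n
    proof (rule AE_I2)
      fix x assume "x \<in> space M"
      then have "cmod (f x - s n x) \<le> 3 * cmod (f x)"
        using bound[of x n] norm_triangle_ineq4[of "f x" "s n x"] by linarith
      then have "(cmod (f x - s n x))\<^sup>2 \<le> (3 * cmod (f x))\<^sup>2" by (intro power_mono) auto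
      then show "norm ((cmod (f x - s n x))\<^sup>2) \<le> 9 * (cmod (f x))\<^sup>2" by (simp add: power_mult_distrib)
    qed
  qed measurable
  then have "(\<lambda>n. L2_norm M (f - s n)) \<longlonglongrightarrow> 0"
    unfolding L2_norm_def by (auto dest: tendsto_real_sqrt)
  then have "\<forall>\<^sub>F n in sequentially. L2_norm M (f - s n) < e" using e by (rule order_tendstoD)
  then show "\<exists>g\<in>closed_span M A. L2_norm M (f - g) < e"
    using s by (auto simp: eventually_sequentially)
qed

lemma indicator_diff_fun:
  "B \<subseteq> C \<Longrightarrow> (indicator (C - B) :: 'a \<Rightarrow> complex) = indicator C - indicator B"
  by (auto simp: fun_eq_iff split: split_indicator)

lemma sum_fun_apply: "(\<Sum>i\<in>I. f i) x = (\<Sum>i\<in>I. (f i x :: 'b :: comm_monoid_add))"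
  by (induction I rule: infinite_finite_induct) auto

text \<open>
  The measurable sets whose indicator lies in the closed span form a Dynkin system: complements are differences of
  indicators, and a disjoint union is the dominated limit of finite sums. As \<open>G\<close> is stable under intersection, this
  system is the whole \<open>\<sigma>\<close>-algebra; hence the closed span contains all simple functions, and these are dense.
\<close>

lemma (in finite_measure) L2_eq_closed_span:
  assumes A: "A \<subseteq> L2 M"
    and G: "Int_stable G" "G \<subseteq> Pow (space M)" "sets M = sigma_sets (space M) G"
    and space: "space M \<in> G"
    and ind: "\<And>B. B \<in> G \<Longrightarrow> indicator B \<in> closed_span M A"
  shows "L2 M = closed_span M A"
proof
  note sub = closed_span_subspace[OF A]
  have indicators: "indicator B \<in> closed_span M A" if "B \<in> sets M" for B
    using that unfolding G(3)
  proof (induction rule: sigma_sets_induct_disjoint[OF G(1,2), consumes 1])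
    case (2)
    have "(indicator {} :: 'a \<Rightarrow> complex) = 0" by (simp add: fun_eq_iff)
    then show ?case using cfun.subspace_0[OF sub] by (simp only:)
  next
    case (3 B)
    then have "B \<subseteq> space M" using G(3) sets.sets_into_space by blast
    then show ?case
      using cfun.subspace_diff[OF sub ind[OF space] 3(2)] by (simp only: indicator_diff_fun)
  next
    case (4 B)
    let ?s = "\<lambda>n. \<Sum>i<n. indicator (B i) :: 'a \<Rightarrow> complex"
    have s: "?s n x = indicator (\<Union>i<n. B i) x" for n x
      using 4(1) by (subst indicator_UN_disjoint) (auto simp: sum_fun_apply disjoint_family_on_def)
    have "range B \<subseteq> sets M" using 4(2) G(3) by blast
    then have "(\<Union>i. B i) \<in> sets M" by auto
    then have L2: "indicator (\<Union>i. B i) \<in> L2 M" by (rule L2_indicator)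
    show ?case
    proof (rule closed_span_dominated_limit[OF A L2, of ?s])
      show "?s n \<in> closed_span M A" for n using 4(3) by (intro cfun.subspace_sum[OF sub])
      show "(\<lambda>n. ?s n x) \<longlonglongrightarrow> indicator (\<Union>i. B i) x" for x
        unfolding s by (rule LIMSEQ_indicator_UN)
      show "cmod (?s n x) \<le> 2 * cmod (indicator (\<Union>i. B i) x)" for n x
        unfolding s by (auto split: split_indicator)
    qed
  qed (rule ind)
  show "L2 M \<subseteq> closed_span M A"
  proof
    fix f assume f: "f \<in> L2 M"
    obtain F where F: "\<And>n. simple_function M (F n)" "\<And>x. x \<in> space M \<Longrightarrow> (\<lambda>n. F n x) \<longlonglongrightarrow> f x"
      "\<And>n x. x \<in> space M \<Longrightarrow> dist (F n x) 0 \<le> 2 * dist (f x) 0"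
      using borel_measurable_implies_sequence_metric[OF L2_measurable[OF f], of 0] by blast
    let ?s = "\<lambda>n. \<Sum>y\<in>F n ` space M. (\<lambda>x. y * indicator (F n -` {y} \<inter> space M) x)"
    have s: "?s n x = F n x" if "x \<in> space M" for n x
    proof -
      have "?s n x = (\<Sum>y\<in>F n ` space M. indicator (F n -` {y} \<inter> space M) x *\<^sub>R y)"
        by (simp add: sum_fun_apply scaleR_conv_of_real of_real_indicator mult.commute)
      also have "\<dots> = F n x"
        by (rule simple_function_indicator_representation_banach[OF F(1) that, symmetric])
      finally show ?thesis .
    qed
    show "f \<in> closed_span M A"
    proof (rule closed_span_dominated_limit[OF A f, of ?s])
      show "?s n \<in> closed_span M A" for n
        by (rule cfun.subspace_sum[OF sub], rule cfun.subspace_scale[OF sub], rule indicators,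
            rule simple_functionD(2)[OF F(1)])
    qed (use F s in auto)
  qed
qed (rule closed_span_subset_L2)

section \<open>Cylinder functions and the wavelets\<close>

abbreviation cyl_fun :: "nat \<Rightarrow> nat list \<Rightarrow> (nat \<Rightarrow> nat) \<Rightarrow> complex" where
  "cyl_fun N w \<equiv> indicator (cylinder N w)"

text \<open>
  The refinement step at the word \<open>v\<close>. It is defined for all words, and not only for the one-letter words at which
  the wavelets sit, so that the family is invariant under the operators \<open>S\<^sub>i\<close> up to scalars.
\<close>

definition detail :: "nat \<Rightarrow> (nat \<Rightarrow> real) \<Rightarrow> nat list \<Rightarrow> nat \<Rightarrow> (nat \<Rightarrow> nat) \<Rightarrow> complex" where
  "detail N p v j = cyl_fun N (v @ [j]) - (\<lambda>x. of_real (p j) * cyl_fun N v x)"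

lemma cylinder_snoc_subset: "cylinder N (v @ [j]) \<subseteq> cylinder N v"
  by (auto simp: cylinder_def nth_append split: if_splits)

text \<open>
  A point of \<open>Z(v)\<close> lies in exactly one of the smaller cylinders, namely the one given by its next letter. The equation
  holds at every point of the type, since both sides vanish outside the Cantor set.
\<close>

lemma cyl_fun_split: "cyl_fun N v = (\<Sum>j<N. cyl_fun N (v @ [j]))"
proof
  fix x
  have "cyl_fun N (v @ [j]) x = (if j = x (length v) then cyl_fun N v x else 0)" for j
    by (auto simp: cylinder_def nth_append less_Suc_eq split: split_indicator)
  then show "cyl_fun N v x = (\<Sum>j<N. cyl_fun N (v @ [j])) x"
    by (auto simp: sum_fun_apply cylinder_def cantor_space_eq split: split_indicator)
qed

lemma S_op_cyl_fun:
  assumes "i < N" "v \<in> words N n"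
  shows "S_op N p i (cyl_fun N v) = (\<lambda>x. of_real (p i powr (-1/2)) * cyl_fun N (i # v) x)"
  unfolding shift_vimage_cylinder[OF assms, symmetric]
  by (auto simp: S_op_def fun_eq_iff split: split_indicator)

lemma S_op_diff: "S_op N p i (f - g) = S_op N p i f - S_op N p i g"
  by (auto simp: S_op_def fun_eq_iff algebra_simps)

lemma words_append: "v \<in> words N m \<Longrightarrow> w \<in> words N n \<Longrightarrow> v @ w \<in> words N (m + n)"
  by (auto simp: words_def)

lemma S_op_detail:
  assumes i: "i < N" and v: "v \<in> words N n" and j: "j < N"
  shows "S_op N p i (detail N p v j) = (\<lambda>x. of_real (p i powr (-1/2)) * detail N p (i # v) j x)"
proof -
  have "v @ [j] \<in> words N (n + 1)" using v j by (intro words_append) (auto simp: words_def)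
  then show ?thesis
    by (simp add: detail_def S_op_diff S_op_linear S_op_cyl_fun[OF i v] S_op_cyl_fun[OF i]
        fun_eq_iff algebra_simps)
qed

definition word_scale :: "(nat \<Rightarrow> real) \<Rightarrow> nat list \<Rightarrow> complex" where
  "word_scale p w = (\<Prod>i\<leftarrow>w. of_real (p i powr (-1/2)))"

lemma word_scale_nonzero: "(\<And>i. i \<in> set w \<Longrightarrow> p i > 0) \<Longrightarrow> word_scale p w \<noteq> 0"
  by (induction w) (auto simp: word_scale_def, force)

lemma S_word_detail:
  assumes w: "w \<in> words N m" and v: "v \<in> words N n" and j: "j < N"
  shows "S_word N p w (detail N p v j) = (\<lambda>x. word_scale p w * detail N p (w @ v) j x)"
  using w
proof (induction w arbitrary: m)
  case Nil
  then show ?case by (simp add: S_word_def word_scale_def)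
next
  case (Cons i w)
  have i: "i < N" and w: "w \<in> words N (length w)" using Cons.prems by (auto simp: words_def)
  have "S_word N p (i # w) (detail N p v j) = S_op N p i (S_word N p w (detail N p v j))"
    by (simp add: S_word_def)
  also have "\<dots> = (\<lambda>x. word_scale p w * S_op N p i (detail N p (w @ v) j) x)"
    unfolding Cons.IH[OF w] by (rule S_op_linear)
  also have "\<dots> = (\<lambda>x. word_scale p (i # w) * detail N p ((i # w) @ v) j x)"
    by (simp add: S_op_detail[OF i words_append[OF w v] j] word_scale_def algebra_simps)
  finally show ?case .
qed

context
  fixes N p M
  assumes M: "markov_measure N p M"
begin

interpretation prob_space M
  using M by (simp add: markov_measure_def)

lemma cyl_fun_L2: "cyl_fun N w \<in> L2 M"
  using cylinder_in_sets[OF M] by (rule L2_indicator)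

lemma detail_L2: "detail N p v j \<in> L2 M"
  unfolding detail_def by (intro L2_diff L2_scale cyl_fun_L2)

lemma integrable_cyl_fun: "integrable M (cyl_fun N v)"
proof -
  have "integrable M (indicator (cylinder N v) :: _ \<Rightarrow> real)"
    using cylinder_in_sets[OF M] by (simp add: emeasure_eq_measure)
  then have "integrable M (\<lambda>x. of_real (indicator (cylinder N v) x) :: complex)"
    by (rule integrable_of_real)
  then show ?thesis by (simp add: of_real_indicator)
qed

lemma integral_cyl_fun: "v \<in> words N n \<Longrightarrow> (\<integral>x. cyl_fun N v x \<partial>M) = of_real (\<Prod>i<n. p (v ! i))"
proof -
  assume v: "v \<in> words N n"
  have "(\<integral>x. cyl_fun N v x \<partial>M) = (\<integral>x. of_real (indicator (cylinder N v) x) \<partial>M)"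
    by (simp add: of_real_indicator)
  also have "\<dots> = of_real (measure M (cylinder N v))"
    using sets.sets_into_space[OF cylinder_in_sets[OF M, of v]]
    by (simp add: Int_absorb2)
  finally show ?thesis using measure_cylinder[OF M v] by simp
qed

text \<open>
  A cylinder \<open>Z(u)\<close> with \<open>u\<close> not longer than \<open>v\<close> either contains \<open>Z(v)\<close> or misses it. In the first case the inner
  product is \<open>\<mu>(Z(vj)) - p\<^sub>j \<mu>(Z(v)) = 0\<close>, in the second the supports are disjoint.
\<close>

lemma detail_orthogonal_cyl_fun:
  assumes v: "v \<in> words N n" and j: "j < N" and u: "length u \<le> n"
  shows "L2_inner M (detail N p v j) (cyl_fun N u) = 0"
proof (cases "take (length u) v = u")
  case True
  have vj: "v @ [j] \<in> words N (Suc n)" using v j by (auto simp: words_def)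
  have len: "length v = n" using v by (simp add: words_def)
  have "cylinder N v \<subseteq> cylinder N u"
    using u len True by (auto simp: cylinder_def) (metis nth_take)
  then have "detail N p v j x * cnj (cyl_fun N u x) = cyl_fun N (v @ [j]) x - of_real (p j) * cyl_fun N v x" for x
    using cylinder_snoc_subset[of N v j] by (auto simp: detail_def split: split_indicator)
  then have "L2_inner M (detail N p v j) (cyl_fun N u)
      = (\<integral>x. cyl_fun N (v @ [j]) x - of_real (p j) * cyl_fun N v x \<partial>M)"
    by (simp add: L2_inner_def)
  also have "\<dots> = (\<integral>x. cyl_fun N (v @ [j]) x \<partial>M) - of_real (p j) * (\<integral>x. cyl_fun N v x \<partial>M)"
    by (simp add: integrable_cyl_fun)
  also have "\<dots> = 0"
    unfolding integral_cyl_fun[OF v] integral_cyl_fun[OF vj]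
    using len by (simp add: nth_append mult.commute)
  finally show ?thesis .
next
  case False
  then obtain i where i: "i < length u" "v ! i \<noteq> u ! i"
    using u v by (auto simp: words_def list_eq_iff_nth_eq)
  then have "cylinder N v \<inter> cylinder N u = {}"
    using u v by (auto simp: words_def cylinder_def)
  then have "detail N p v j x * cnj (cyl_fun N u x) = 0" for x
    using cylinder_snoc_subset[of N v j] by (auto simp: detail_def split: split_indicator)
  then show ?thesis by (simp only: L2_inner_def Bochner_Integration.integral_zero)
qed

end

theorem theorem3p8:
  fixes N :: nat and p :: "nat \<Rightarrow> real" and \<mu> :: "(nat \<Rightarrow> nat) measure"
  assumes "N > 1"
    and "\<forall>i<N. p i > 0"
    and "(\<Sum>i<N. p i) = 1"
    and "markov_measure N p \<mu>"
  shows "\<exists>(\<phi> :: nat \<Rightarrow> (nat \<Rightarrow> nat) \<Rightarrow> complex) (\<psi> :: nat \<Rightarrow> nat \<Rightarrow> (nat \<Rightarrow> nat) \<Rightarrow> complex).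
           (\<forall>k<N. \<phi> k \<in> L2 \<mu>) \<and>
           (\<forall>k<N. \<forall>j. 1 \<le> j \<and> j \<le> N - 1 \<longrightarrow> \<psi> j k \<in> L2 \<mu>) \<and>
           (\<forall>n. orthogonal_sets \<mu> (scaling_space N \<mu> \<phi>) (wavelet_space N p \<mu> \<psi> n)) \<and>
           (\<forall>m n. m \<noteq> n \<longrightarrow>
              orthogonal_sets \<mu> (wavelet_space N p \<mu> \<psi> m) (wavelet_space N p \<mu> \<psi> n)) \<and>
           L2 \<mu> = closed_span \<mu> (scaling_space N \<mu> \<phi> \<union> (\<Union>n. wavelet_space N p \<mu> \<psi> n))"
proof -
  interpret prob_space \<mu> using assms(4) by (simp add: markov_measure_def)
  note M = assms(4)
  have pos: "p i > 0" if "i < N" for i using assms(2) that by blast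
  define \<phi> where "\<phi> k = cyl_fun N [k]" for k
  define \<psi> where "\<psi> j k = detail N p [k] j" for j k
  define V where "V = {\<phi> k | k. k < N}"
  define W where "W n = {S_word N p w (\<psi> j k) | w j k. k < N \<and> 1 \<le> j \<and> j \<le> N - 1 \<and> w \<in> words N n}" for n
  have spaces: "scaling_space N \<mu> \<phi> = closed_span \<mu> V" "wavelet_space N p \<mu> \<psi> n = closed_span \<mu> (W n)" for n
    by (simp_all add: scaling_space_def V_def wavelet_space_def W_def)
  have W_eq: "W n = {(\<lambda>x. word_scale p w * detail N p (w @ [k]) j x) | w j k.
                       k < N \<and> 1 \<le> j \<and> j < N \<and> w \<in> words N n}" for n
  proof -
    have *: "S_word N p w (\<psi> j k) = (\<lambda>x. word_scale p w * detail N p (w @ [k]) j x)"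
      if "k < N" "j < N" "w \<in> words N n" for w j k
      unfolding \<psi>_def using that by (intro S_word_detail[of _ _ n _ 1]) (auto simp: words_def)
    have "j \<le> N - 1 \<longleftrightarrow> j < N" for j using \<open>N > 1\<close> by auto
    then have "f = S_word N p w (\<psi> j k) \<and> k < N \<and> 1 \<le> j \<and> j \<le> N - 1 \<and> w \<in> words N n \<longleftrightarrow>
        f = (\<lambda>x. word_scale p w * detail N p (w @ [k]) j x) \<and> k < N \<and> 1 \<le> j \<and> j < N \<and> w \<in> words N n" for f w j k
      using *[of k j w] by (cases "k < N \<and> j < N \<and> w \<in> words N n") auto
    then show ?thesis unfolding W_def by (simp only:)
  qed
  have VL2: "V \<subseteq> L2 \<mu>" by (auto simp: V_def \<phi>_def cyl_fun_L2[OF M])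
  have WL2: "W n \<subseteq> L2 \<mu>" for n
    by (auto simp: W_eq intro!: L2_scale detail_L2[OF M])

  \<comment> \<open>The functions in \<open>W n\<close> sit at words of length \<open>n + 1\<close>, the prefix of length \<open>n\<close> being followed by the letter of
    the scaling function; this produces the bound \<open>n + 1\<close>.\<close>
  have W_cyl: "L2_inner \<mu> f (cyl_fun N u) = 0" if f: "f \<in> W n" and u: "length u \<le> n + 1" for f n u
  proof -
    obtain w j k where *: "f = (\<lambda>x. word_scale p w * detail N p (w @ [k]) j x)"
      "k < N" "j < N" "w \<in> words N n"
      using f by (auto simp: W_eq)
    have "w @ [k] \<in> words N (n + 1)" using * by (auto simp: words_def)
    then show ?thesis
      unfolding *(1) L2_inner_scale using detail_orthogonal_cyl_fun[OF M _ \<open>j < N\<close> u] by simp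
  qed
  have WV: "orthogonal_sets \<mu> (W n) V" for n
    unfolding orthogonal_sets_def V_def \<phi>_def using W_cyl by auto
  have WW_less: "orthogonal_sets \<mu> (W n) (W m)" if "m < n" for m n
    unfolding orthogonal_sets_def
  proof (intro ballI)
    fix f g assume f: "f \<in> W n" and g: "g \<in> W m"
    obtain w j k where *: "g = (\<lambda>x. word_scale p w * detail N p (w @ [k]) j x)" "w \<in> words N m"
      using g by (auto simp: W_eq)
    have fL2: "f \<in> L2 \<mu>" using f WL2 by blast
    \<comment> \<open>A generator of \<open>W m\<close> is built from cylinders over words of length at most \<open>m + 2 \<le> n + 1\<close>.\<close>
    have cyl: "L2_inner \<mu> (cyl_fun N u) f = 0" if "length u \<le> m + 2" for u
      using W_cyl[OF f, of u] that \<open>m < n\<close> L2_inner_commute[of \<mu> "cyl_fun N u" f] by simp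
    have "length w = m" using *(2) by (simp add: words_def)
    then have "L2_inner \<mu> (detail N p (w @ [k]) j) f = 0"
      unfolding detail_def
      by (subst L2_inner_diff[OF cyl_fun_L2[OF M] L2_scale[OF cyl_fun_L2[OF M]] fL2])
        (simp add: L2_inner_scale cyl)
    then have "L2_inner \<mu> g f = 0" by (simp add: *(1) L2_inner_scale)
    then show "L2_inner \<mu> f g = 0" using L2_inner_commute[of \<mu> f g] by simp
  qed
  have WW: "orthogonal_sets \<mu> (W m) (W n)" if "m \<noteq> n" for m n
    using WW_less[of m n] WW_less[of n m] that orthogonal_sets_commute by (metis nat_neq_iff)

  let ?D = "closed_span \<mu> V \<union> (\<Union>n. closed_span \<mu> (W n))"
  have DL2: "?D \<subseteq> L2 \<mu>" using closed_span_subset_L2 by blast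
  have gens: "V \<subseteq> cfun.span ?D" "W n \<subseteq> cfun.span ?D" for n
    using closed_span_superset[OF VL2] closed_span_superset[OF WL2, of n] cfun.span_superset[of ?D] by blast+
  \<comment> \<open>Induction on the length: a child \<open>vi\<close> with \<open>i \<ge> 1\<close> is a wavelet plus a multiple of its parent, and the child
    \<open>v0\<close> is the parent minus all other children.\<close>
  have cyl_span: "cyl_fun N w \<in> cfun.span ?D" if "w \<in> words N (Suc n)" for w n
    using that
  proof (induction n arbitrary: w)
    case 0
    then obtain k where "w = [k]" "k < N" by (auto simp: words_def length_Suc_conv)
    then show ?case using gens(1) by (auto simp: V_def \<phi>_def)
  next
    case (Suc n)
    then obtain v j where w: "w = v @ [j]" "v \<in> words N (Suc n)" "j < N"
      by (cases w rule: rev_cases) (auto simp: words_def)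
    have v: "cyl_fun N v \<in> cfun.span ?D" using Suc.IH w(2) .
    have child: "cyl_fun N (v @ [i]) \<in> cfun.span ?D" if i: "1 \<le> i" "i < N" for i
    proof -
      obtain u k where uk: "v = u @ [k]" "u \<in> words N n" "k < N"
        using w(2) by (cases v rule: rev_cases) (auto simp: words_def)
      have nz: "word_scale p u \<noteq> 0"
        using uk(2) pos by (intro word_scale_nonzero) (auto simp: words_def)
      have "(\<lambda>x. word_scale p u * detail N p v i x) \<in> cfun.span ?D"
        using gens(2)[of n] uk i by (auto simp: W_eq)
      from cfun.span_scale[OF this, of "1 / word_scale p u"]
      have "detail N p v i \<in> cfun.span ?D" using nz by simp
      from cfun.span_add[OF this cfun.span_scale[OF v, of "of_real (p i)"]]
      show ?thesis by (simp add: detail_def)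
    qed
    show ?case
    proof (cases "j = 0")
      case True
      have "{..<N} = insert 0 {1..<N}" using \<open>N > 1\<close> by auto
      then have "cyl_fun N w = cyl_fun N v - (\<Sum>i\<in>{1..<N}. cyl_fun N (v @ [i]))"
        using cyl_fun_split[of N v] w(1) True by simp
      moreover have "\<dots> \<in> cfun.span ?D"
        by (rule cfun.span_diff[OF v cfun.span_sum]) (use child in simp)
      ultimately show ?thesis by (simp only:)
    qed (use w child in auto)
  qed
  \<comment> \<open>Only the empty word is new: the whole space is the union of the one-letter cylinders.\<close>
  have cyl_span': "cyl_fun N w \<in> cfun.span ?D" if "w \<in> words N n" for w n
  proof (cases n)
    case 0
    then have "cyl_fun N w = (\<Sum>j<N. cyl_fun N [j])"
      using cyl_fun_split[of N "[]"] that by (simp add: words_def)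
    moreover have "cyl_fun N [j] \<in> cfun.span ?D" if "j < N" for j
      using that by (intro cyl_span[of _ 0]) (auto simp: words_def)
    ultimately show ?thesis by (auto intro!: cfun.span_sum)
  qed (use cyl_span that in auto)

  have "L2 \<mu> = closed_span \<mu> ?D"
  proof (rule L2_eq_closed_span[OF DL2 Int_stable_cylinders[of N]])
    have space: "space \<mu> = cantor_space N" using M by (simp add: markov_measure_def)
    show "cylinders N \<subseteq> Pow (space \<mu>)" "sets \<mu> = sigma_sets (space \<mu>) (cylinders N)"
      using cylinders_subset sets_markov[OF M] space by simp_all
    show "space \<mu> \<in> cylinders N"
      unfolding space cylinder_Nil[symmetric] by (auto simp: cylinders_def words_def)
    show "indicator B \<in> closed_span \<mu> ?D" if B: "B \<in> cylinders N" for B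
    proof (cases "B = {}")
      case True
      then have "(indicator B :: _ \<Rightarrow> complex) = 0" by (simp add: fun_eq_iff)
      then show ?thesis using cfun.subspace_0[OF closed_span_subspace[OF DL2]] by (simp only:)
    next
      case False
      then show ?thesis
        using B cyl_span' span_subset_closed_span[OF DL2] by (auto simp: cylinders_def)
    qed
  qed
  moreover have "orthogonal_sets \<mu> (closed_span \<mu> V) (closed_span \<mu> (W n))" for n
    using WV orthogonal_sets_commute by (intro orthogonal_closed_spans VL2 WL2) blast
  moreover have "orthogonal_sets \<mu> (closed_span \<mu> (W m)) (closed_span \<mu> (W n))" if "m \<noteq> n" for m n
    by (intro orthogonal_closed_spans WL2 WW that)
  moreover have "\<phi> k \<in> L2 \<mu>" "\<psi> j k \<in> L2 \<mu>" for j k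
    by (simp_all add: \<phi>_def \<psi>_def cyl_fun_L2[OF M] detail_L2[OF M])
  ultimately show ?thesis
    by (intro exI[of _ \<phi>] exI[of _ \<psi>]) (simp add: spaces)
qed

end
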